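(* Let $\mathscr{H}$ be a reproducing kernel Hilbert space on a non-empty set $\mathscr{X}$, let $\theta\in(0,\frac{\pi}{2})$, and let $T\in\Pi^{\mathbf{Ber}}_{\theta}$. Then, for each choice of the sign $\pm$, $$\mathbf{ber}(T)\ \ge\ \frac{\csc\theta}{2}\,\mathbf{ber}\big(\Re(T)\pm\Im(T)\big)+\frac{\csc\theta}{2}\Big(\mathbf{ber}(\Im(T))-\mathbf{ber}(\Re(T))\Big).$$
   Context: $\mathscr{H}$ is a complex separable reproducing kernel Hilbert space of complex-valued functions on a non-empty set $\mathscr{X}$: for every $\lambda\in\mathscr{X}$ evaluation at $\lambda$ is continuous, and $k_\lambda\in\mathscr{H}$ denotes the reproducing kernel, $\phi(\lambda)=\langle\phi,k_\lambda\rangle$ for all $\phi\in\mathscr{H}$. It is implicit that $k_\lambda\neq0$, and $\hat k_\lambda=k_\lambda/\|k_\lambda\|$. $\mathscr{B}(\mathscr{H})$ is the algebra of bounded linear operators on $\mathscr{H}$. For $T\in\mathscr{B}(\mathscr{H})$: $\Re(T)=\frac12(T+T^* )$, $\Im(T)=\frac1{2i}(T-T^* )$; the Berezin transform is $\widetilde T(\lambda)=\langle T\hat k_\lambda,\hat k_\lambda\rangle$; the Berezin range is $\mathbf{Ber}(T)=\{\widetilde T(\lambda):\lambda\in\mathscr{X}\}$; the Berezin number is $\mathbf{ber}(T)=\sup_{\lambda\in\mathscr{X}}|\widetilde T(\lambda)|$. For $\theta\in[0,\frac{\pi}{2})$, $S_\theta=\{z\in\mathbb{C}:|\arg z|\le\theta\}$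 is the sector with vertex at the origin (vertex included) and semi-angle $\theta$, and $\Pi^{\mathbf{Ber}}_\theta$ is the class of $T\in\mathscr{B}(\mathscr{H})$ with $\mathbf{Ber}(T)\subseteq S_\theta$ (Berezin sectorial operators). *)

theory Defs
  imports "HOL-Analysis.Analysis" "HOL-Library.Function_Algebras"
begin

section \<open>Complex Hilbert spaces of functions\<close>

text \<open>
  The underlying set is the (automatically non-empty) type \<open>'x\<close>. A Hilbert space of functions is
  given by a carrier \<open>H\<close> of functions and an inner product \<open>ip\<close>, linear in its first argument; the
  values of \<open>ip\<close> outside \<open>H\<close> are unconstrained. Sums, differences and \<open>0\<close> of functions are the
  pointwise ones.
\<close>

type_synonym 'x cfun = "'x \<Rightarrow> complex"

type_synonym 'x cinner = "'x cfun \<Rightarrow> 'x cfun \<Rightarrow> complex"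

definition fscale :: "complex \<Rightarrow> 'x cfun \<Rightarrow> 'x cfun" where
  "fscale c f = (\<lambda>x. c * f x)"

definition ip_norm :: "'x cinner \<Rightarrow> 'x cfun \<Rightarrow> real" where
  "ip_norm ip f = sqrt (Re (ip f f))"

text \<open>
  The value \<open>0\<close> off the carrier is needed because the library locale \<open>Metric_space\<close> requires
  nonnegativity and symmetry for all arguments, not just those in the carrier.
\<close>

definition ip_dist :: "'x cfun set \<Rightarrow> 'x cinner \<Rightarrow> 'x cfun \<Rightarrow> 'x cfun \<Rightarrow> real" where
  "ip_dist H ip f g = (if f \<in> H \<and> g \<in> H then ip_norm ip (f - g) else 0)"

locale inner_product_function_space =
  fixes H :: "'x cfun set" and ip :: "'x cinner"
  assumes zero_mem: "0 \<in> H"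
    and add_mem: "\<lbrakk>f \<in> H; g \<in> H\<rbrakk> \<Longrightarrow> f + g \<in> H"
    and scale_mem: "f \<in> H \<Longrightarrow> fscale c f \<in> H"
    and ip_add_left: "\<lbrakk>f \<in> H; g \<in> H; h \<in> H\<rbrakk> \<Longrightarrow> ip (f + g) h = ip f h + ip g h"
    and ip_scale_left: "\<lbrakk>f \<in> H; g \<in> H\<rbrakk> \<Longrightarrow> ip (fscale c f) g = c * ip f g"
    and ip_commute: "\<lbrakk>f \<in> H; g \<in> H\<rbrakk> \<Longrightarrow> ip g f = cnj (ip f g)"
    and ip_self_nonneg: "f \<in> H \<Longrightarrow> 0 \<le> Re (ip f f)"
    and ip_self_eq_0: "\<lbrakk>f \<in> H; ip f f = 0\<rbrakk> \<Longrightarrow> f = 0"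

definition ip_topology :: "'x cfun set \<Rightarrow> 'x cinner \<Rightarrow> 'x cfun topology" where
  "ip_topology H ip = Metric_space.mtopology H (ip_dist H ip)"

definition reproducing_kernel :: "'x cfun set \<Rightarrow> 'x cinner \<Rightarrow> 'x \<Rightarrow> 'x cfun" where
  "reproducing_kernel H ip l = (THE k. k \<in> H \<and> (\<forall>f\<in>H. f l = ip f k))"

locale separable_rkhs = inner_product_function_space H ip
  for H :: "'x cfun set" and ip :: "'x cinner" +
  assumes complete: "Metric_space.mcomplete H (ip_dist H ip)"
    and separable: "separable_space (ip_topology H ip)"
    and evaluation_continuous: "continuous_map (ip_topology H ip) euclidean (\<lambda>f. f l)"
    and kernel_nonzero: "reproducing_kernel H ip l \<noteq> 0"


section \<open>Bounded operators\<close>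

text \<open>
  An operator is a total function on all functions, of which only the restriction to \<open>H\<close> matters.
\<close>

type_synonym 'x operator = "'x cfun \<Rightarrow> 'x cfun"

definition bounded_operators :: "'x cfun set \<Rightarrow> 'x cinner \<Rightarrow> 'x operator set" where
  "bounded_operators H ip = {T.
     T ` H \<subseteq> H \<and>
     (\<forall>f\<in>H. \<forall>g\<in>H. T (f + g) = T f + T g) \<and>
     (\<forall>c. \<forall>f\<in>H. T (fscale c f) = fscale c (T f)) \<and>
     (\<exists>C. \<forall>f\<in>H. ip_norm ip (T f) \<le> C * ip_norm ip f)}"

definition adjoint_op :: "'x cfun set \<Rightarrow> 'x cinner \<Rightarrow> 'x operator \<Rightarrow> 'x operator" where
  "adjoint_op H ip T g = (THE h. h \<in> H \<and> (\<forall>f\<in>H. ip (T f) g = ip f h))"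

definition Re_op :: "'x cfun set \<Rightarrow> 'x cinner \<Rightarrow> 'x operator \<Rightarrow> 'x operator" where
  "Re_op H ip T = (\<lambda>f. fscale (1 / 2) (T f + adjoint_op H ip T f))"

definition Im_op :: "'x cfun set \<Rightarrow> 'x cinner \<Rightarrow> 'x operator \<Rightarrow> 'x operator" where
  "Im_op H ip T = (\<lambda>f. fscale (1 / (2 * \<i>)) (T f - adjoint_op H ip T f))"


section \<open>Berezin transform, range and number\<close>

definition normalized_kernel :: "'x cfun set \<Rightarrow> 'x cinner \<Rightarrow> 'x \<Rightarrow> 'x cfun" where
  "normalized_kernel H ip l =
     (let k = reproducing_kernel H ip l in fscale (complex_of_real (1 / ip_norm ip k)) k)"

definition berezin_transform :: "'x cfun set \<Rightarrow> 'x cinner \<Rightarrow> 'x operator \<Rightarrow> 'x \<Rightarrow> complex" where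
  "berezin_transform H ip T l = ip (T (normalized_kernel H ip l)) (normalized_kernel H ip l)"

definition berezin_range :: "'x cfun set \<Rightarrow> 'x cinner \<Rightarrow> 'x operator \<Rightarrow> complex set" where
  "berezin_range H ip T = range (berezin_transform H ip T)"

definition berezin_number :: "'x cfun set \<Rightarrow> 'x cinner \<Rightarrow> 'x operator \<Rightarrow> real" where
  "berezin_number H ip T = (SUP l. cmod (berezin_transform H ip T l))"

definition sector :: "real \<Rightarrow> complex set" where
  "sector \<theta> = {z. z = 0 \<or> \<bar>Arg z\<bar> \<le> \<theta>}"

definition berezin_sectorial :: "'x cfun set \<Rightarrow> 'x cinner \<Rightarrow> real \<Rightarrow> 'x operator set" where
  "berezin_sectorial H ip \<theta> = {T \<in> bounded_operators H ip. berezin_range H ip T \<subseteq> sector \<theta>}"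

end

theory Submission
  imports Defs
begin

text \<open>
  For \<open>z\<close> in the sector of semi-angle \<open>\<theta>\<close> one has \<open>\<bar>Im z\<bar> \<le> sin \<theta> \<cdot> \<bar>z\<bar>\<close>, and the Berezin
  transforms of the real and imaginary part of \<open>T\<close> are the real and imaginary part of the Berezin
  transform of \<open>T\<close>. Hence \<open>ber (\<Im> T) \<le> sin \<theta> \<cdot> ber T\<close>, and subadditivity of the Berezin number
  bounds \<open>ber (\<Re> T \<plusminus> \<Im> T)\<close> by \<open>ber (\<Re> T) + ber (\<Im> T)\<close>. Kernels and adjoints, which are defined
  by definite descriptions, exist by the Riesz representation theorem.
\<close>

section \<open>Elementary geometry of the inner product and its norm\<close>

context inner_product_function_space
begin

lemma uminus_mem: "f \<in> H \<Longrightarrow> - f \<in> H"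
  using scale_mem[of f "-1"] by (simp add: fscale_def fun_Compl_def)

lemma diff_mem: "\<lbrakk>f \<in> H; g \<in> H\<rbrakk> \<Longrightarrow> f - g \<in> H"
  using add_mem[of f "- g"] uminus_mem[of g] by simp

lemma ip_uminus_left: "\<lbrakk>f \<in> H; g \<in> H\<rbrakk> \<Longrightarrow> ip (- f) g = - ip f g"
  using ip_scale_left[of f g "-1"] by (simp add: fscale_def fun_Compl_def)

lemma ip_diff_left: "\<lbrakk>f \<in> H; g \<in> H; h \<in> H\<rbrakk> \<Longrightarrow> ip (f - g) h = ip f h - ip g h"
  using ip_add_left[of f "- g" h] by (simp add: uminus_mem ip_uminus_left)

lemma ip_add_right: "\<lbrakk>f \<in> H; g \<in> H; h \<in> H\<rbrakk> \<Longrightarrow> ip f (g + h) = ip f g + ip f h"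
  by (metis add_mem complex_cnj_add ip_add_left ip_commute)

lemma ip_diff_right: "\<lbrakk>f \<in> H; g \<in> H; h \<in> H\<rbrakk> \<Longrightarrow> ip f (g - h) = ip f g - ip f h"
  by (metis diff_mem complex_cnj_diff ip_diff_left ip_commute)

lemma ip_scale_right: "\<lbrakk>f \<in> H; g \<in> H\<rbrakk> \<Longrightarrow> ip f (fscale c g) = cnj c * ip f g"
  by (metis scale_mem complex_cnj_mult ip_scale_left ip_commute)

lemmas ip_linear = ip_add_left ip_diff_left ip_scale_left ip_add_right ip_diff_right ip_scale_right
  add_mem diff_mem scale_mem

lemma ip_norm_nonneg: "f \<in> H \<Longrightarrow> 0 \<le> ip_norm ip f"
  by (simp add: ip_norm_def ip_self_nonneg)

lemma ip_norm_sq: "f \<in> H \<Longrightarrow> (ip_norm ip f)\<^sup>2 = Re (ip f f)"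
  by (simp add: ip_norm_def ip_self_nonneg)

lemma ip_self: "f \<in> H \<Longrightarrow> ip f f = complex_of_real ((ip_norm ip f)\<^sup>2)"
  using ip_commute[of f f] by (simp add: ip_norm_sq complex_eq_iff)

lemma ip_norm_eq_0: "\<lbrakk>f \<in> H; ip_norm ip f = 0\<rbrakk> \<Longrightarrow> f = 0"
  by (simp add: ip_self ip_self_eq_0)

lemma ip_norm_zero: "ip_norm ip 0 = 0"
  using ip_diff_left[OF zero_mem zero_mem zero_mem] by (simp add: ip_norm_def)

lemma ip_norm_scale: "f \<in> H \<Longrightarrow> ip_norm ip (fscale c f) = cmod c * ip_norm ip f"
proof -
  assume f: "f \<in> H"
  have "c * cnj c = complex_of_real ((cmod c)\<^sup>2)" by (rule complex_norm_square[symmetric])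
  then have "ip (fscale c f) (fscale c f) = complex_of_real ((cmod c * ip_norm ip f)\<^sup>2)"
    using f by (simp add: ip_linear ip_self[OF f] power_mult_distrib mult_ac)
  then show ?thesis
    by (simp add: ip_norm_def[of ip "fscale c f"] ip_norm_nonneg f del: of_real_power of_real_mult)
qed

lemma ip_norm_minus_commute: "\<lbrakk>f \<in> H; g \<in> H\<rbrakk> \<Longrightarrow> ip_norm ip (f - g) = ip_norm ip (g - f)"
  using ip_norm_scale[of "g - f" "-1"] diff_mem[of g f]
  by (simp add: fscale_def fun_diff_def)

lemma Cauchy_Schwarz:
  assumes f: "f \<in> H" and g: "g \<in> H"
  shows "cmod (ip f g) \<le> ip_norm ip f * ip_norm ip g"
proof (cases "ip_norm ip g = 0")
  case True
  \<comment> \<open>Here \<open>g\<close> vanishes; writing it as a difference lets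
    \<open>ip_diff_right\<close> annihilate \<open>ip f g\<close>.\<close>
  then have "g = g - g" using ip_norm_eq_0[OF g] by simp
  then have "ip f g = 0" using ip_diff_right[OF f g g] by simp
  then show ?thesis by (simp add: True)
next
  case False
  define a where "a = ip_norm ip f"
  define b where "b = ip_norm ip g"
  define w where "w = ip f g"
  have b: "b > 0" using False ip_norm_nonneg[OF g] by (simp add: b_def)
  \<comment> \<open>Up to the factor \<open>b\<^sup>2\<close>, this is the component of
    \<open>f\<close> orthogonal to \<open>g\<close>; clearing the denominator avoids division. Its
    squared norm has the Cauchy-Schwarz defect as a factor.\<close>
  define u where "u = fscale (complex_of_real (b\<^sup>2)) f - fscale w g"
  have "ip u u = complex_of_real (b\<^sup>2 * (a\<^sup>2 * b\<^sup>2)) - complex_of_real (b\<^sup>2) * (w * cnj w)"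
    unfolding u_def using f g ip_commute[OF f g]
    by (simp add: ip_linear ip_self[OF f] ip_self[OF g] flip: a_def b_def w_def) (simp add: algebra_simps)
  also have "\<dots> = complex_of_real (b\<^sup>2 * (a\<^sup>2 * b\<^sup>2 - (cmod w)\<^sup>2))"
    by (simp add: complex_norm_square algebra_simps flip: of_real_power)
  finally have "Re (ip u u) = b\<^sup>2 * (a\<^sup>2 * b\<^sup>2 - (cmod w)\<^sup>2)"
    by (simp only: Re_complex_of_real)
  moreover have "0 \<le> Re (ip u u)" by (rule ip_self_nonneg) (simp add: u_def f g ip_linear)
  ultimately have "(cmod w)\<^sup>2 \<le> (a * b)\<^sup>2" using b by (simp add: zero_le_mult_iff power_mult_distrib)
  moreover have "0 \<le> a * b" using b ip_norm_nonneg[OF f] by (simp add: a_def)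
  ultimately show ?thesis unfolding a_def b_def w_def by (rule power2_le_imp_le)
qed

lemma ip_norm_triangle:
  assumes f: "f \<in> H" and g: "g \<in> H"
  shows "ip_norm ip (f + g) \<le> ip_norm ip f + ip_norm ip g"
proof (rule power2_le_imp_le)
  have "(ip_norm ip (f + g))\<^sup>2 = (ip_norm ip f)\<^sup>2 + (ip_norm ip g)\<^sup>2 + 2 * Re (ip f g)"
    using f g ip_commute[OF f g] by (simp add: ip_norm_sq ip_linear)
  also have "\<dots> \<le> (ip_norm ip f)\<^sup>2 + (ip_norm ip g)\<^sup>2 + 2 * (ip_norm ip f * ip_norm ip g)"
    using Cauchy_Schwarz[OF f g] complex_Re_le_cmod[of "ip f g"] by linarith
  finally show "(ip_norm ip (f + g))\<^sup>2 \<le> (ip_norm ip f + ip_norm ip g)\<^sup>2"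
    by (simp add: power2_sum)
qed (use f g in \<open>simp add: ip_norm_nonneg\<close>)

text \<open>Completeness and the topology are phrased through \<open>Metric_space\<close>, so this
  unlocks the library facts about them.\<close>

lemma Metric_space_ip_dist: "Metric_space H (ip_dist H ip)"
proof
  show "0 \<le> ip_dist H ip f g" for f g
    by (simp add: ip_dist_def ip_norm_nonneg diff_mem)
  show "ip_dist H ip f g = ip_dist H ip g f" for f g
    by (simp add: ip_dist_def ip_norm_minus_commute)
  show "ip_dist H ip f g = 0 \<longleftrightarrow> f = g" if "f \<in> H" "g \<in> H" for f g
    using that ip_norm_eq_0[of "f - g"] diff_mem[of f g]
    by (auto simp: ip_dist_def ip_norm_zero)
  show "ip_dist H ip f h \<le> ip_dist H ip f g + ip_dist H ip g h"
    if "f \<in> H" "g \<in> H" "h \<in> H" for f g h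
    using that ip_norm_triangle[of "f - g" "g - h"] by (simp add: ip_dist_def diff_mem)
qed

section \<open>Riesz representation, by a variational argument\<close>

text \<open>The representing vector minimises \<open>\<parallel>f\<parallel>\<^sup>2 - 2 Re (L f)\<close>.\<close>

theorem Riesz_representation:
  assumes complete: "Metric_space.mcomplete H (ip_dist H ip)"
    and L_add: "\<And>f g. \<lbrakk>f \<in> H; g \<in> H\<rbrakk> \<Longrightarrow> L (f + g) = L f + L g"
    and L_scale: "\<And>c f. f \<in> H \<Longrightarrow> L (fscale c f) = c * L f"
    and L_bound: "\<And>f. f \<in> H \<Longrightarrow> cmod (L f) \<le> C * ip_norm ip f"
  shows "\<exists>h\<in>H. \<forall>f\<in>H. L f = ip f h"
proof -
  interpret M: Metric_space H "ip_dist H ip" by (rule Metric_space_ip_dist)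
  \<comment> \<open>If \<open>h\<close> represents \<open>L\<close>, then \<open>J f\<close> is the
    squared distance from \<open>f\<close> to \<open>h\<close> minus the squared norm of
    \<open>h\<close>; hence the search for a minimiser.\<close>
  define J where "J f = Re (ip f f) - 2 * Re (L f)" for f
  have J_ge: "- C\<^sup>2 \<le> J f" if "f \<in> H" for f
  proof -
    have "Re (L f) \<le> C * ip_norm ip f"
      using L_bound[OF that] complex_Re_le_cmod[of "L f"] by linarith
    \<comment> \<open>Completing the square: with \<open>a\<close> the norm of \<open>f\<close>,
      \<open>J f\<close> is at least \<open>a\<^sup>2 - 2 * C * a\<close>.\<close>
    moreover have "0 \<le> (ip_norm ip f - C)\<^sup>2" by simp
    ultimately show ?thesis
      by (simp add: J_def power2_diff ip_norm_sq that algebra_simps)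
  qed
  define m where "m = (INF f\<in>H. J f)"
  have bdd: "bdd_below (J ` H)" using J_ge by (rule bdd_belowI2)
  have m_le: "m \<le> J f" if "f \<in> H" for f
    unfolding m_def using bdd that by (rule cINF_lower)
  \<comment> \<open>The parallelogram law, with the contributions of \<open>L\<close> cancelling by
    linearity. As \<open>J\<close> is at least \<open>m\<close> at the midpoint, two near-minimisers
    must be close.\<close>
  have parallelogram: "(ip_norm ip (f - g))\<^sup>2 = 2 * J f + 2 * J g - 4 * J (fscale (1/2) (f + g))"
    if "f \<in> H" "g \<in> H" for f g
    using that ip_commute[OF that]
    by (simp add: J_def ip_norm_sq ip_linear L_add L_scale add_divide_distrib)
  have "\<exists>f. f \<in> H \<and> J f < m + 1 / real (Suc i)" for i
  proof -
    have "J ` H \<noteq> {}" using zero_mem by blast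
    moreover have "Inf (J ` H) < m + 1 / real (Suc i)" by (simp add: m_def)
    ultimately show ?thesis using cInf_lessD[of "J ` H"] by blast
  qed
  then obtain s where s: "\<And>i. s i \<in> H" and Js: "\<And>i. J (s i) < m + 1 / real (Suc i)"
    by metis
  have "M.MCauchy s"
    unfolding M.MCauchy_def
  proof (intro conjI allI impI)
    show "range s \<subseteq> H" using s by auto
    fix e :: real assume "e > 0"
    \<comment> \<open>Values of \<open>J\<close> within \<open>\<delta>\<close> of \<open>m\<close>
      give squared distance below \<open>4 * \<delta>\<close> by \<open>parallelogram\<close>,
      whence the quarter.\<close>
    then obtain N where N: "inverse (real (Suc N)) < e\<^sup>2 / 4"
      using reals_Archimedean[of "e\<^sup>2 / 4"] by auto
    show "\<exists>N. \<forall>i j. N \<le> i \<longrightarrow> N \<le> j \<longrightarrow> ip_dist H ip (s i) (s j) < e"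
    proof (intro exI allI impI)
      fix i j assume ij: "N \<le> i" "N \<le> j"
      have "1 / real (Suc i) \<le> inverse (real (Suc N))" "1 / real (Suc j) \<le> inverse (real (Suc N))"
        using ij by (simp_all add: field_simps)
      moreover have "m \<le> J (fscale (1/2) (s i + s j))" by (simp add: m_le s ip_linear)
      ultimately have "(ip_norm ip (s i - s j))\<^sup>2 < e\<^sup>2"
        using parallelogram[OF s s, of i j] Js[of i] Js[of j] N by linarith
      then show "ip_dist H ip (s i) (s j) < e"
        using \<open>e > 0\<close> by (simp add: ip_dist_def s power2_less_imp_less)
    qed
  qed
  then obtain h where "limitin M.mtopology s h sequentially"
    using complete unfolding M.mcomplete_def by blast
  then have h: "h \<in> H" and lim: "\<And>e. e > 0 \<Longrightarrow> \<exists>N. \<forall>i\<ge>N. ip_dist H ip (s i) h < e"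
    unfolding M.limit_metric_sequentially by blast+
  \<comment> \<open>The norm and \<open>L\<close> both converge along \<open>s\<close>, the former
    by the reverse triangle inequality and the latter by \<open>L_bound\<close>. Hence
    \<open>J (s i)\<close> tends to \<open>J h\<close>, and \<open>h\<close> attains the
    infimum.\<close>
  have dist_0: "(\<lambda>i. ip_norm ip (s i - h)) \<longlonglongrightarrow> 0"
    unfolding LIMSEQ_iff
    using lim h s by (simp add: ip_dist_def ip_norm_nonneg diff_mem)
  have "(\<lambda>i. ip_norm ip (s i) - ip_norm ip h) \<longlonglongrightarrow> 0"
  proof (rule Lim_null_comparison[OF always_eventually dist_0], rule allI)
    fix i
    show "norm (ip_norm ip (s i) - ip_norm ip h) \<le> ip_norm ip (s i - h)"
      using ip_norm_triangle[OF diff_mem[OF s h] h, of i]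
        ip_norm_triangle[OF diff_mem[OF h s] s, of i i] ip_norm_minus_commute[OF s h, of i]
      by (simp add: abs_le_iff)
  qed
  then have norm_lim: "(\<lambda>i. ip_norm ip (s i)) \<longlonglongrightarrow> ip_norm ip h"
    by (simp add: LIM_zero_iff)
  have L_diff: "L (s i - h) = L (s i) - L h" for i
    using L_add[OF diff_mem[OF s h] h, of i] by simp
  have "(\<lambda>i. L (s i) - L h) \<longlonglongrightarrow> 0"
  proof (rule Lim_null_comparison[OF always_eventually], rule allI)
    show "norm (L (s i) - L h) \<le> C * ip_norm ip (s i - h)" for i
      using L_bound[OF diff_mem[OF s h]] by (simp add: L_diff)
    show "(\<lambda>i. C * ip_norm ip (s i - h)) \<longlonglongrightarrow> 0"
      using tendsto_mult_left[OF dist_0, of C] by simp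
  qed
  then have L_lim: "(\<lambda>i. L (s i)) \<longlonglongrightarrow> L h" by (simp add: LIM_zero_iff)
  have "(\<lambda>i. (ip_norm ip (s i))\<^sup>2 - 2 * Re (L (s i))) \<longlonglongrightarrow> (ip_norm ip h)\<^sup>2 - 2 * Re (L h)"
    by (intro tendsto_intros norm_lim L_lim)
  then have "(\<lambda>i. J (s i)) \<longlonglongrightarrow> J h" by (simp add: J_def ip_norm_sq s h)
  moreover have "(\<lambda>i. m + 1 / real (Suc i)) \<longlonglongrightarrow> m"
    using tendsto_add[OF tendsto_const LIMSEQ_inverse_real_of_nat, of m]
    by (simp add: inverse_eq_divide)
  ultimately have Jh: "J h \<le> m"
    by (rule LIMSEQ_le) (use Js in \<open>auto intro: less_imp_le\<close>)
  have Re_eq: "Re (L f) = Re (ip f h)" if f: "f \<in> H" for f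
  proof -
    define d where "d = Re (ip f h) - Re (L f)"
    define A where "A = Re (ip f f)"
    \<comment> \<open>The first variation: moving from \<open>h\<close> by \<open>t\<close> times
      \<open>f\<close> changes \<open>J\<close> by \<open>t\<^sup>2 * A + 2 * t * d\<close>. The
      optimal \<open>t\<close> would be \<open>- d / A\<close>; the denominator \<open>A + 1\<close>
      also covers \<open>A = 0\<close> and still makes the change negative unless
      \<open>d = 0\<close>.\<close>
    define t where "t = - d / (A + 1)"
    have A: "0 \<le> A" by (simp add: A_def ip_self_nonneg f)
    have "J (h + fscale (complex_of_real t) f) = J h + t\<^sup>2 * A + 2 * t * d"
      using f h ip_commute[OF f h]
      by (simp add: J_def A_def d_def ip_linear L_add L_scale power2_eq_square
          algebra_simps)
    moreover have "m \<le> J (h + fscale (complex_of_real t) f)" by (simp add: m_le f h ip_linear)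
    ultimately have "0 \<le> t\<^sup>2 * A + 2 * t * d" using Jh by linarith
    also have "t\<^sup>2 * A + 2 * t * d = - (d\<^sup>2 * (A + 2)) / (A + 1)\<^sup>2"
      using A by (simp add: t_def power2_eq_square divide_simps) (simp add: algebra_simps)
    finally have "d\<^sup>2 * (A + 2) \<le> 0" using A by (auto simp: divide_le_0_iff)
    then have "d = 0" using A by (simp add: mult_le_0_iff)
    then show ?thesis by (simp add: d_def)
  qed
  have "L f = ip f h" if "f \<in> H" for f
  proof (rule complex_eqI)
    show "Im (L f) = Im (ip f h)"
      \<comment> \<open>Multiplication by \<open>-\<i>\<close> turns the imaginary part into the
        real part, for which equality is known.\<close>
      using Re_eq[OF scale_mem[OF that, of "-\<i>"]] that h by (simp add: L_scale ip_linear)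
  qed (rule Re_eq[OF that])
  with h show ?thesis by blast
qed

section \<open>Uniqueness of representing vectors, and adjoints\<close>

lemma representing_vector_unique:
  assumes "h \<in> H" "h' \<in> H" "\<And>f. f \<in> H \<Longrightarrow> ip f h = ip f h'"
  shows "h = h'"
proof -
  have "ip (h - h') (h - h') = 0"
    using assms diff_mem[of h h'] by (simp add: ip_diff_right)
  then show ?thesis using ip_self_eq_0[of "h - h'"] assms by (simp add: diff_mem)
qed

text \<open>For fixed \<open>g\<close>, the functional sending \<open>f\<close> to
  \<open>ip (T f) g\<close> is linear, and Cauchy-Schwarz bounds it. Riesz gives a representing
  vector and uniqueness makes the definite description denote it.\<close>

lemma adjoint_op:
  assumes complete: "Metric_space.mcomplete H (ip_dist H ip)"
    and T: "T \<in> bounded_operators H ip" and g: "g \<in> H"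
  shows "adjoint_op H ip T g \<in> H" and "\<And>f. f \<in> H \<Longrightarrow> ip (T f) g = ip f (adjoint_op H ip T g)"
proof -
  have T_mem: "\<And>f. f \<in> H \<Longrightarrow> T f \<in> H"
    and T_add: "\<And>f g. \<lbrakk>f \<in> H; g \<in> H\<rbrakk> \<Longrightarrow> T (f + g) = T f + T g"
    and T_scale: "\<And>c f. f \<in> H \<Longrightarrow> T (fscale c f) = fscale c (T f)"
    and "\<exists>C. \<forall>f\<in>H. ip_norm ip (T f) \<le> C * ip_norm ip f"
    using T by (auto simp: bounded_operators_def)
  then obtain C where C: "\<And>f. f \<in> H \<Longrightarrow> ip_norm ip (T f) \<le> C * ip_norm ip f"
    by blast
  have "\<exists>h\<in>H. \<forall>f\<in>H. ip (T f) g = ip f h"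
  proof (rule Riesz_representation[OF complete])
    fix f assume f: "f \<in> H"
    have "cmod (ip (T f) g) \<le> ip_norm ip (T f) * ip_norm ip g"
      by (rule Cauchy_Schwarz) (use f g T_mem in auto)
    also have "\<dots> \<le> (C * ip_norm ip f) * ip_norm ip g"
      by (intro mult_right_mono C ip_norm_nonneg f g)
    finally show "cmod (ip (T f) g) \<le> (C * ip_norm ip g) * ip_norm ip f" by (simp add: mult_ac)
  qed (simp_all add: T_add T_scale T_mem g ip_linear)
  then have "\<exists>!h. h \<in> H \<and> (\<forall>f\<in>H. ip (T f) g = ip f h)"
    using representing_vector_unique by (metis (no_types, lifting))
  from theI'[OF this] show "adjoint_op H ip T g \<in> H"
    and "\<And>f. f \<in> H \<Longrightarrow> ip (T f) g = ip f (adjoint_op H ip T g)"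
    unfolding adjoint_op_def by blast+
qed

end

section \<open>Reproducing kernels and Berezin transforms\<close>

context separable_rkhs
begin

text \<open>Continuity at \<open>0\<close> keeps evaluation below \<open>1\<close> in modulus on
  some ball; homogeneity spreads this to a linear bound, the form that Riesz requires.\<close>

lemma evaluation_bounded: "\<exists>C. \<forall>f\<in>H. cmod (f l) \<le> C * ip_norm ip f"
proof -
  interpret M: Metric_space H "ip_dist H ip" by (rule Metric_space_ip_dist)
  have "continuous_map M.mtopology euclidean (\<lambda>f. f l)"
    using evaluation_continuous by (simp add: ip_topology_def)
  then have "openin M.mtopology {f \<in> topspace M.mtopology. f l \<in> ball 0 1}"
    by (rule openin_continuous_map_preimage) simp
  moreover have "0 \<in> {f \<in> topspace M.mtopology. f l \<in> ball 0 1}"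
    using zero_mem by simp
  ultimately obtain r where r: "r > 0" "M.mball 0 r \<subseteq> {f \<in> topspace M.mtopology. f l \<in> ball 0 1}"
    unfolding M.openin_mtopology by blast
  have small: "cmod (f l) < 1" if "f \<in> H" "ip_norm ip f < r" for f
  proof -
    have "ip_dist H ip 0 f = ip_norm ip f"
      using that zero_mem ip_norm_minus_commute[OF zero_mem that(1)] by (simp add: ip_dist_def)
    then have "f \<in> M.mball 0 r" using that zero_mem by (simp add: M.in_mball)
    then show ?thesis using r(2) by auto
  qed
  have "cmod (f l) \<le> (2 / r) * ip_norm ip f" if f: "f \<in> H" for f
  proof (cases "ip_norm ip f = 0")
    case True
    then show ?thesis using ip_norm_eq_0[OF f] by simp
  next
    case False
    then have p: "ip_norm ip f > 0" using ip_norm_nonneg[OF f] by simp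
    \<comment> \<open>Rescales \<open>f\<close> to norm \<open>r / 2\<close>, strictly inside the
      ball, whence the constant \<open>2 / r\<close>.\<close>
    define c where "c = r / (2 * ip_norm ip f)"
    have c: "c > 0" using p r by (simp add: c_def)
    have "ip_norm ip (fscale (complex_of_real c) f) < r"
      using p r by (simp add: ip_norm_scale f c_def norm_divide norm_mult)
    then have "cmod (fscale (complex_of_real c) f l) < 1" using small f scale_mem by blast
    then have "c * cmod (f l) < 1" using c by (simp add: fscale_def norm_mult)
    then show ?thesis using p r by (simp add: c_def field_simps)
  qed
  then show ?thesis by blast
qed

lemma reproducing_kernel_mem: "reproducing_kernel H ip l \<in> H"
proof -
  obtain C where C: "\<And>f. f \<in> H \<Longrightarrow> cmod (f l) \<le> C * ip_norm ip f"
    using evaluation_bounded by blast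
  have "\<exists>k\<in>H. \<forall>f\<in>H. f l = ip f k"
    by (rule Riesz_representation[OF complete, where C = C]) (simp_all add: C fscale_def)
  then have "\<exists>!k. k \<in> H \<and> (\<forall>f\<in>H. f l = ip f k)"
    using representing_vector_unique by (metis (no_types, lifting))
  from theI'[OF this] show ?thesis
    unfolding reproducing_kernel_def by blast
qed

lemma normalized_kernel_mem: "normalized_kernel H ip l \<in> H"
  by (simp add: normalized_kernel_def Let_def scale_mem reproducing_kernel_mem)

lemma ip_norm_normalized_kernel: "ip_norm ip (normalized_kernel H ip l) = 1"
proof -
  have "ip_norm ip (reproducing_kernel H ip l) > 0"
    using kernel_nonzero ip_norm_eq_0 ip_norm_nonneg reproducing_kernel_mem
    by (metis order_le_less)
  then show ?thesis
    by (simp add: normalized_kernel_def Let_def ip_norm_scale reproducing_kernel_mem norm_divide)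
qed

text \<open>A real \<open>SUP\<close> dominates its family only once that is bounded. Cauchy-Schwarz
  with unit vectors gives any operator bound of \<open>T\<close> as an upper bound.\<close>

lemma bdd_above_berezin_transform:
  assumes T: "T \<in> bounded_operators H ip"
  shows "bdd_above (range (\<lambda>l. cmod (berezin_transform H ip T l)))"
proof -
  have T_mem: "\<And>f. f \<in> H \<Longrightarrow> T f \<in> H"
    and "\<exists>C. \<forall>f\<in>H. ip_norm ip (T f) \<le> C * ip_norm ip f"
    using T by (auto simp: bounded_operators_def)
  then obtain C where C: "\<And>f. f \<in> H \<Longrightarrow> ip_norm ip (T f) \<le> C * ip_norm ip f"
    by blast
  have "cmod (berezin_transform H ip T l) \<le> C" for l
    using Cauchy_Schwarz[OF T_mem[OF normalized_kernel_mem] normalized_kernel_mem, of l l]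
      C[OF normalized_kernel_mem, of l]
    by (simp add: berezin_transform_def ip_norm_normalized_kernel)
  then show ?thesis by (rule bdd_aboveI2)
qed

text \<open>Pairing the adjoint with the same vector conjugates the transform of \<open>T\<close>,
  so all four values are determined by the single complex number \<open>B T l\<close>.\<close>

lemma berezin_transform_parts:
  assumes T: "T \<in> bounded_operators H ip"
  defines "B \<equiv> berezin_transform H ip"
  shows "B (Re_op H ip T) l = complex_of_real (Re (B T l))"
    and "B (Im_op H ip T) l = complex_of_real (Im (B T l))"
    and "B (Re_op H ip T + Im_op H ip T) l = complex_of_real (Re (B T l) + Im (B T l))"
    and "B (Re_op H ip T - Im_op H ip T) l = complex_of_real (Re (B T l) - Im (B T l))"
proof -
  define u where "u = normalized_kernel H ip l"
  define v where "v = adjoint_op H ip T u"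
  have u: "u \<in> H" by (simp add: u_def normalized_kernel_mem)
  have Tu: "T u \<in> H" using T u by (auto simp: bounded_operators_def)
  have v: "v \<in> H" unfolding v_def by (rule adjoint_op(1)[OF complete T u])
  have vu: "ip v u = cnj (ip (T u) u)"
    using adjoint_op(2)[OF complete T u u] ip_commute[OF u v] by (simp add: v_def)
  have mem: "Re_op H ip T u \<in> H" "Im_op H ip T u \<in> H"
    by (simp_all add: Re_op_def Im_op_def ip_linear Tu v flip: v_def)
  have Re: "ip (Re_op H ip T u) u = complex_of_real (Re (ip (T u) u))"
    by (simp add: Re_op_def ip_linear Tu v u vu complex_eq_iff flip: v_def)
  have Im: "ip (Im_op H ip T u) u = complex_of_real (Im (ip (T u) u))"
    by (simp add: Im_op_def ip_linear Tu v u vu complex_eq_iff Re_divide Im_divide flip: v_def)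
  show "B (Re_op H ip T) l = complex_of_real (Re (B T l))"
    and "B (Im_op H ip T) l = complex_of_real (Im (B T l))"
    and "B (Re_op H ip T + Im_op H ip T) l = complex_of_real (Re (B T l) + Im (B T l))"
    and "B (Re_op H ip T - Im_op H ip T) l = complex_of_real (Re (B T l) - Im (B T l))"
    using mem u
    by (simp_all add: B_def berezin_transform_def Re Im ip_linear flip: u_def)
qed

end

text \<open>In polar form the imaginary part is the modulus times \<open>sin (Arg z)\<close>, and
  sine is increasing on the interval from \<open>- pi / 2\<close> to \<open>pi / 2\<close>.\<close>

lemma sector_abs_Im_le:
  assumes "z \<in> sector \<theta>" "0 < \<theta>" "\<theta> < pi / 2"
  shows "\<bar>Im z\<bar> \<le> sin \<theta> * cmod z"
proof (cases "z = 0")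
  case False
  then have a: "\<bar>Arg z\<bar> \<le> \<theta>" using assms by (simp add: sector_def)
  have "Im z = cmod z * sin (Arg z)"
    using arg_cong[OF rcis_cmod_Arg[of z], of Im] by (simp add: Im_rcis)
  moreover have "\<bar>sin (Arg z)\<bar> \<le> sin \<theta>"
    using sin_monotone_2pi_le[of "Arg z" \<theta>] sin_monotone_2pi_le[of "- Arg z" \<theta>] a assms
    by (auto simp: abs_le_iff)
  ultimately show ?thesis
    by (simp add: abs_mult mult.commute mult_left_mono)
qed simp

theorem theorem3p2:
  fixes H :: "('x \<Rightarrow> complex) set"
    and ip :: "('x \<Rightarrow> complex) \<Rightarrow> ('x \<Rightarrow> complex) \<Rightarrow> complex"
    and T :: "('x \<Rightarrow> complex) \<Rightarrow> ('x \<Rightarrow> complex)"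
    and \<theta> :: real
  assumes "separable_rkhs H ip"
    and "0 < \<theta>" and "\<theta> < pi / 2"
    and "T \<in> berezin_sectorial H ip \<theta>"
  shows "berezin_number H ip T \<ge>
           (1 / sin \<theta>) / 2 * berezin_number H ip (Re_op H ip T + Im_op H ip T)
         + (1 / sin \<theta>) / 2 * (berezin_number H ip (Im_op H ip T) - berezin_number H ip (Re_op H ip T))
       \<and> berezin_number H ip T \<ge>
           (1 / sin \<theta>) / 2 * berezin_number H ip (Re_op H ip T - Im_op H ip T)
         + (1 / sin \<theta>) / 2 * (berezin_number H ip (Im_op H ip T) - berezin_number H ip (Re_op H ip T))"
proof -
  interpret separable_rkhs H ip by fact
  let ?R = "Re_op H ip T" and ?I = "Im_op H ip T" and ?ber = "berezin_number H ip"
  define B where "B = berezin_transform H ip T"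
  have T: "T \<in> bounded_operators H ip" and sect: "\<And>l. B l \<in> sector \<theta>"
    using assms(4) by (auto simp: berezin_sectorial_def berezin_range_def B_def)
  note parts = berezin_transform_parts[OF T, folded B_def]
  have sin: "sin \<theta> > 0" using assms by (simp add: sin_gt_zero2)
  have B_le: "cmod (B l) \<le> ?ber T" for l
    unfolding berezin_number_def B_def
    by (rule cSUP_upper[OF UNIV_I bdd_above_berezin_transform[OF T]])
  \<comment> \<open>These bounds make the suprema for \<open>?R\<close> and \<open>?I\<close> well
    behaved without showing that the two are bounded operators.\<close>
  have "\<bar>Re (B l)\<bar> \<le> ?ber T" "\<bar>Im (B l)\<bar> \<le> ?ber T" for l
    using B_le[of l] abs_Re_le_cmod[of "B l"] abs_Im_le_cmod[of "B l"] by linarith+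
  then have bdd: "bdd_above (range (\<lambda>l. \<bar>Re (B l)\<bar>))" "bdd_above (range (\<lambda>l. \<bar>Im (B l)\<bar>))"
    by (auto intro!: bdd_aboveI2)
  have R: "\<bar>Re (B l)\<bar> \<le> ?ber ?R" for l
    using cSUP_upper[OF UNIV_I bdd(1), of l] by (simp add: berezin_number_def parts)
  have I: "\<bar>Im (B l)\<bar> \<le> ?ber ?I" for l
    using cSUP_upper[OF UNIV_I bdd(2), of l] by (simp add: berezin_number_def parts)
  \<comment> \<open>The one place where sectoriality enters, and the source of the cosecant.\<close>
  have I_le: "?ber ?I \<le> sin \<theta> * ?ber T"
    unfolding berezin_number_def[of H ip ?I]
  proof (rule cSUP_least)
    fix l
    have "\<bar>Im (B l)\<bar> \<le> sin \<theta> * cmod (B l)" by (rule sector_abs_Im_le[OF sect assms(2,3)])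
    also have "\<dots> \<le> sin \<theta> * ?ber T" using B_le sin by simp
    finally show "cmod (berezin_transform H ip ?I l) \<le> sin \<theta> * ?ber T" by (simp add: parts)
  qed simp
  \<comment> \<open>Both signs follow pointwise: the transform is the sum or difference of the real
    numbers \<open>Re (B l)\<close> and \<open>Im (B l)\<close>.\<close>
  have plus: "?ber (?R + ?I) \<le> ?ber ?R + ?ber ?I"
    unfolding berezin_number_def[of H ip "?R + ?I"]
  proof (rule cSUP_least)
    show "cmod (berezin_transform H ip (?R + ?I) l) \<le> ?ber ?R + ?ber ?I" for l
      using R[of l] I[of l] by (simp only: parts norm_of_real)
  qed simp
  have minus: "?ber (?R - ?I) \<le> ?ber ?R + ?ber ?I"
    unfolding berezin_number_def[of H ip "?R - ?I"]
  proof (rule cSUP_least)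
    show "cmod (berezin_transform H ip (?R - ?I) l) \<le> ?ber ?R + ?ber ?I" for l
      using R[of l] I[of l] by (simp only: parts norm_of_real)
  qed simp
  \<comment> \<open>The Berezin number of \<open>?R\<close> cancels, leaving twice that of
    \<open>?I\<close>, which \<open>I_le\<close> controls; division by
    \<open>2 * sin \<theta>\<close> finishes.\<close>
  have combine: "(1 / sin \<theta>) / 2 * x + (1 / sin \<theta>) / 2 * (?ber ?I - ?ber ?R) \<le> ?ber T"
    if "x \<le> ?ber ?R + ?ber ?I" for x
  proof -
    have "x + (?ber ?I - ?ber ?R) \<le> 2 * sin \<theta> * ?ber T" using that I_le by linarith
    then show ?thesis using sin by (simp add: field_simps)
  qed
  from combine[OF plus] combine[OF minus] show ?thesis by blast
qed

end
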